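(* Let $r\ge 0$ and $s,t\ge 1$ be integers with $r+s>1$ and $r+t>1$. Then \[ \begin{split} T(r,s,t) &= \sum_{i = 0}^{s - 2} ( - 1)^i \binom{t+i-1}i\zeta (s - i)\zeta (r + t + i) + ( - 1)^s \sum_{i = 0}^{t - 2} \binom{s+i-1}i\zeta (t - i)\zeta (r + s + i)\\ &\quad- ( - 1)^s \sum_{i = 0}^{t - 2} \binom{s+i-1}i\sum_{\mu = 1}^\infty \frac{H_{\mu ,t - i} }{\mu ^{r + s + i} } - ( - 1)^s \binom{s+t-2}{t-1}\sum_{\mu = 1}^\infty \frac{H_\mu }{\mu ^{r + s + t - 1} }. \end{split} \]
   Context: For integers $\mu\ge 0$ and $n$, $H_{\mu,n}=\sum_{k=1}^\mu k^{-n}$ and $H_\mu=H_{\mu,1}$. $T(r,s,t)=\sum_{\mu=1}^\infty\sum_{\nu=1}^\infty \frac{1}{\mu^r\nu^s(\mu+\nu)^t}$ is the Tornheim double series and $\zeta$ the Riemann zeta function. A sum whose upper limit is one less than its lower limit is empty. *)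

theory Defs
  imports "HOL-Analysis.Harmonic_Numbers"
begin

text \<open>
  A series over \<open>\<mu> = 1, 2, \<dots>\<close> is written as a \<^const>\<open>suminf\<close> over the natural numbers with
  \<open>Suc \<mu>\<close> in place of \<open>\<mu>\<close>.
\<close>

text \<open>The Riemann zeta function at integers \<open>n > 1\<close>, the domain of convergence of the series;
  the value for \<open>n \<le> 1\<close> is meaningless.\<close>

definition zeta :: "nat \<Rightarrow> real" where
  "zeta n = (\<Sum>k. 1 / real (Suc k) ^ n)"

definition gen_harm :: "nat \<Rightarrow> int \<Rightarrow> real" where
  "gen_harm \<mu> n = (\<Sum>k=1..\<mu>. real k powi (- n))"

lemma gen_harm_1: "gen_harm \<mu> 1 = harm \<mu>"
  by (simp add: gen_harm_def harm_def power_int_minus)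

definition tornheim :: "nat \<Rightarrow> nat \<Rightarrow> nat \<Rightarrow> real" where
  "tornheim r s t =
     (\<Sum>\<mu>. \<Sum>\<nu>. 1 / (real (Suc \<mu>) ^ r * real (Suc \<nu>) ^ s * real (Suc \<mu> + Suc \<nu>) ^ t))"

end

theory Submission
  imports Defs
begin

text \<open>
  Expand \<open>1 / (\<nu>\<^sup>s (\<mu> + \<nu>)\<^sup>t)\<close> into partial fractions in \<open>\<nu>\<close> and sum over \<open>\<nu>\<close> for fixed \<open>\<mu>\<close>.
  The powers of \<open>\<nu>\<close> with exponent at least 2 give zeta values, those of \<open>\<mu> + \<nu>\<close> give tails of zeta
  values, and the two terms of exponent 1 have opposite coefficients, so that
  together they telescope to \<open>H\<^sub>\<mu>\<close>. It remains to divide by \<open>\<mu>\<^sup>r\<close> and sum over \<open>\<mu>\<close> term by term.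
\<close>

section \<open>Partial fractions with poles of arbitrary order\<close>

text \<open>
  The principal part at \<open>z = 0\<close> of \<open>1 / (z\<^sup>s (z + a)\<^sup>t)\<close>. For \<open>t = 0\<close> truncated subtraction makes the
  binomial coefficient vanish except at \<open>i = 0\<close>, as it should.
\<close>

definition principal_part :: "'a::field \<Rightarrow> 'a \<Rightarrow> nat \<Rightarrow> nat \<Rightarrow> 'a" where
  "principal_part a z s t =
     (\<Sum>i<s. (-1) ^ i * of_nat ((t + i - 1) choose i) / (a ^ (t + i) * z ^ (s - i)))"

lemma principal_part_0_left [simp]: "principal_part a z 0 t = 0"
  by (simp add: principal_part_def)

lemma principal_part_0_right: "principal_part a z (Suc s) 0 = 1 / z ^ Suc s"
  unfolding principal_part_def
  by (subst sum.lessThan_Suc_shift) (simp add: binomial_eq_0)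

text \<open>After the term \<open>i = 0\<close> is split off, Pascal's rule for
  \<open>(t + i + 1) choose Suc i\<close> separates the remaining sum into the two principal parts
  on the right.\<close>

lemma principal_part_Suc_Suc:
  assumes "a \<noteq> 0"
  shows "principal_part a z (Suc s) (Suc t) =
           (principal_part a z (Suc s) t - principal_part a z s (Suc t)) / a"
proof -
  have "principal_part a z (Suc s) (Suc t) =
      1 / (a ^ Suc t * z ^ Suc s) +
      (\<Sum>i<s. (-1) ^ Suc i * of_nat ((t + i + 1) choose Suc i) / (a ^ (t + i + 2) * z ^ (s - i)))"
    unfolding principal_part_def by (subst sum.lessThan_Suc_shift) simp
  also have "(\<Sum>i<s. (-1) ^ Suc i * of_nat ((t + i + 1) choose Suc i) / (a ^ (t + i + 2) * z ^ (s - i)))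
      = (\<Sum>i<s. (-1) ^ Suc i * of_nat ((t + i) choose Suc i) / (a ^ (t + i + 1) * z ^ (s - i)) / a
              - (-1) ^ i * of_nat ((t + i) choose i) / (a ^ (t + i + 1) * z ^ (s - i)) / a)"
    by (intro sum.cong) (simp_all add: add_divide_distrib diff_divide_distrib algebra_simps)
  also have "1 / (a ^ Suc t * z ^ Suc s) + \<dots> =
      (1 / (a ^ t * z ^ Suc s) +
        (\<Sum>i<s. (-1) ^ Suc i * of_nat ((t + i) choose Suc i) / (a ^ (t + i + 1) * z ^ (s - i)))
      - (\<Sum>i<s. (-1) ^ i * of_nat ((t + i) choose i) / (a ^ (t + i + 1) * z ^ (s - i)))) / a"
    by (simp add: sum_subtractf sum_divide_distrib add_divide_distrib diff_divide_distrib mult.commute mult.left_commute)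
  also have "1 / (a ^ t * z ^ Suc s) +
        (\<Sum>i<s. (-1) ^ Suc i * of_nat ((t + i) choose Suc i) / (a ^ (t + i + 1) * z ^ (s - i)))
      = principal_part a z (Suc s) t"
    unfolding principal_part_def by (subst sum.lessThan_Suc_shift) simp
  also have "(\<Sum>i<s. (-1) ^ i * of_nat ((t + i) choose i) / (a ^ (t + i + 1) * z ^ (s - i)))
      = principal_part a z s (Suc t)"
    by (simp add: principal_part_def)
  finally show ?thesis .
qed

text \<open>Induction via \<open>1 / (x (x + a)) = (1 / x - 1 / (x + a)) / a\<close>.\<close>

lemma partial_fractions:
  fixes a x :: "'a::field"
  assumes "a \<noteq> 0" "x \<noteq> 0" "x + a \<noteq> 0" "s + t > 0"
  shows "1 / (x ^ s * (x + a) ^ t) = principal_part a x s t + principal_part (- a) (x + a) t s"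
  using assms(4)
proof (induction "s + t" arbitrary: s t)
  case 0
  then show ?case by simp
next
  case (Suc n)
  show ?case
  proof (cases "s = 0 \<or> t = 0")
    case True
    then show ?thesis
      using Suc.prems by (cases s; cases t) (auto simp: principal_part_0_right)
  next
    case False
    then obtain p q where [simp]: "s = Suc p" "t = Suc q"
      by (meson not0_implies_Suc)
    have "1 / (x ^ s * (x + a) ^ t) = (1 / (x ^ s * (x + a) ^ q) - 1 / (x ^ p * (x + a) ^ t)) / a"
      using assms(1-3) by (simp add: divide_simps)
    also have "\<dots> = (principal_part a x s q + principal_part (- a) (x + a) q s
        - (principal_part a x p t + principal_part (- a) (x + a) t p)) / a"
      using Suc.hyps(1)[of s q] Suc.hyps(1)[of p t] Suc.hyps(2) by simp
    \<comment> \<open>At the other pole the recursion is used with \<open>- a\<close>; dividing by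
      \<open>- a\<close> instead of \<open>a\<close> exchanges the two terms of the
      difference.\<close>
    also have "\<dots> = principal_part a x s t + principal_part (- a) (x + a) t s"
      using assms(1) by (simp add: principal_part_Suc_Suc diff_divide_distrib add_divide_distrib)
    finally show ?thesis .
  qed
qed

text \<open>The simple pole \<open>i = s - 1\<close> is set apart because the series of
  \<open>1 / z\<close> diverges on its own.\<close>

lemma principal_part_last:
  assumes "s \<ge> 1"
  shows "principal_part a z s t =
    (\<Sum>i<s-1. (-1) ^ i * of_nat ((t + i - 1) choose i) / (a ^ (t + i) * z ^ (s - i)))
    + (-1) ^ (s - 1) * of_nat ((s + t - 2) choose (s - 1)) / (a ^ (s + t - 1) * z)"
proof -
  obtain p where "s = Suc p"
    using assms by (metis Suc_le_D One_nat_def)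
  then show ?thesis
    by (simp add: principal_part_def add.commute)
qed

text \<open>The sign \<open>(-1) ^ i\<close> cancels against that of \<open>(- a) ^ (s + i)\<close>,
  which leaves \<open>(-1) ^ s\<close> in every term.\<close>

lemma principal_part_uminus_last:
  assumes "s \<ge> 1" "t \<ge> 1"
  shows "principal_part (- a) z t s =
    (-1) ^ s * (\<Sum>i<t-1. of_nat ((s + i - 1) choose i) / (a ^ (s + i) * z ^ (t - i)))
    + (-1) ^ s * of_nat ((s + t - 2) choose (t - 1)) / (a ^ (s + t - 1) * z)"
proof -
  have sign: "(-1) ^ i * c / ((- a) ^ (s + i) * w) = (-1) ^ s * (c / (a ^ (s + i) * w))" for i c w
    by (cases "even s"; cases "even i") (auto simp: power_minus_odd)
  have "(-1) ^ (t - 1) * c / ((- a) ^ (t + s - 1) * z) = (-1) ^ s * c / (a ^ (s + t - 1) * z)" for c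
    using sign[of "t - 1" c z] assms by (simp add: add.commute)
  then show ?thesis
    unfolding principal_part_last[OF assms(2)] sign sum_distrib_left by (simp add: add.commute)
qed

section \<open>Evaluation of the inner series\<close>

lemma zeta_sums:
  assumes "k > 1"
  shows "(\<lambda>n. 1 / real (Suc n) ^ k) sums zeta k"
proof -
  have "summable (\<lambda>n. 1 / real (Suc n) ^ k)"
    using inverse_power_summable[of k, where 'a = real] assms
    by (subst summable_Suc_iff) (simp add: inverse_eq_divide)
  then show ?thesis
    by (simp add: zeta_def summable_sums)
qed

lemma gen_harm_altdef: "gen_harm m (int k) = (\<Sum>n<m. 1 / real (Suc n) ^ k)"
  by (simp add: gen_harm_def sum.atLeast1_atMost_eq power_int_minus field_simps
      flip: power_int_of_nat)

lemma zeta_tail_sums: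
  assumes "k > 1"
  shows "(\<lambda>n. 1 / real (Suc n + m) ^ k) sums (zeta k - gen_harm m (int k))"
  using sums_split_initial_segment[OF zeta_sums[OF assms], of m]
  by (simp add: gen_harm_altdef)

text \<open>Evaluates the paired simple poles. Raising \<open>m\<close> by one adds a telescoping
  series with sum \<open>1 / real (Suc m)\<close>.\<close>

lemma harm_sums:
  "(\<lambda>n. 1 / real (Suc n) - 1 / real (Suc n + m)) sums (harm m :: real)"
proof (induction m)
  case 0
  then show ?case by (simp add: harm_def)
next
  case (Suc m)
  have "(\<lambda>n. 1 / real (Suc n + m)) \<longlonglongrightarrow> 0"
    using LIMSEQ_ignore_initial_segment[OF LIMSEQ_inverse_real_of_nat, of m]
    by (simp add: inverse_eq_divide)
  from telescope_sums'[OF this]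
  have "(\<lambda>n. 1 / real (Suc n + m) - 1 / real (Suc n + Suc m)) sums (1 / real (Suc m))"
    by simp
  from sums_add[OF Suc.IH this] show ?case
    by (simp add: harm_Suc inverse_eq_divide)
qed

lemma tornheim_inner_sums:
  fixes s t m :: nat
  assumes "s \<ge> 1" "t \<ge> 1" "m \<ge> 1"
  shows "(\<lambda>\<nu>. 1 / (real (Suc \<nu>) ^ s * real (m + Suc \<nu>) ^ t)) sums
      ((\<Sum>i<s-1. (-1) ^ i * real ((t + i - 1) choose i) * (zeta (s - i) / real m ^ (t + i)))
     + (-1) ^ s * (\<Sum>i<t-1. real ((s + i - 1) choose i) *
          ((zeta (t - i) - gen_harm m (int (t - i))) / real m ^ (s + i)))
     - (-1) ^ s * real ((s + t - 2) choose (t - 1)) * (harm m / real m ^ (s + t - 1)))"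
proof -
  \<comment> \<open>The residues at the two simple poles are opposite, because \<open>s - 1\<close>
    and \<open>t - 1\<close> add up to \<open>s + t - 2\<close>. This permits the pairing in
    \<open>expand\<close>.\<close>
  have signs: "(-1) ^ (s - 1) * real ((s + t - 2) choose (s - 1)) =
      - ((-1) ^ s * real ((s + t - 2) choose (t - 1)))"
  proof -
    have "(s + t - 2) choose (s - 1) = (s + t - 2) choose (t - 1)"
      using assms by (subst binomial_symmetric) auto
    moreover have "(-1::real) ^ (s - 1) = - ((-1) ^ s)"
      using assms by (cases s) auto
    ultimately show ?thesis by simp
  qed
  have expand: "1 / (real (Suc \<nu>) ^ s * real (m + Suc \<nu>) ^ t) =
      (\<Sum>i<s-1. (-1) ^ i * real ((t + i - 1) choose i) * (1 / real (Suc \<nu>) ^ (s - i) / real m ^ (t + i)))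
     + (-1) ^ s * (\<Sum>i<t-1. real ((s + i - 1) choose i) *
          (1 / real (Suc \<nu> + m) ^ (t - i) / real m ^ (s + i)))
     - (-1) ^ s * real ((s + t - 2) choose (t - 1)) *
          ((1 / real (Suc \<nu>) - 1 / real (Suc \<nu> + m)) / real m ^ (s + t - 1))" for \<nu>
  proof -
    define x where "x = real (Suc \<nu>)"
    have x: "real (Suc \<nu> + m) = x + real m" "real (m + Suc \<nu>) = x + real m"
      "real m \<noteq> 0" "x \<noteq> 0" "x + real m \<noteq> 0" "s + t > 0"
      using assms by (auto simp: x_def)
    show ?thesis
      unfolding x(1,2) x_def[symmetric] partial_fractions[OF x(3-)]
        principal_part_last[OF assms(1)] principal_part_uminus_last[OF assms(1,2)] signs
      by (simp add: diff_divide_distrib right_diff_distrib mult.commute)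
  qed
  show ?thesis
    unfolding expand
    \<comment> \<open>The ranges \<open>i < s - 1\<close> and \<open>i < t - 1\<close> keep the
      exponents \<open>s - i\<close> and \<open>t - i\<close> above 1.\<close>
    by (intro sums_add sums_diff sums_mult sums_sum sums_divide zeta_sums zeta_tail_sums harm_sums)
      auto
qed

section \<open>Convergence of the outer series\<close>

lemma gen_harm_nonneg: "gen_harm m (int k) \<ge> 0"
  by (simp add: gen_harm_altdef sum_nonneg)

lemma gen_harm_le_zeta:
  assumes "k > 1"
  shows "gen_harm m (int k) \<le> zeta k"
  using sum_le_suminf[OF sums_summable[OF zeta_sums[OF assms]], of "{..<m}"]
  by (simp add: gen_harm_altdef zeta_def)

lemma summable_gen_harm:
  assumes "k > 1" "p > 1"
  shows "summable (\<lambda>n. gen_harm (Suc n) (int k) / real (Suc n) ^ p)"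
proof (rule summable_comparison_test'[of "\<lambda>n. zeta k * (1 / real (Suc n) ^ p)" 0])
  show "summable (\<lambda>n. zeta k * (1 / real (Suc n) ^ p))"
    using zeta_sums[OF assms(2)] by (intro summable_mult) (rule sums_summable)
next
  fix n :: nat
  show "norm (gen_harm (Suc n) (int k) / real (Suc n) ^ p) \<le> zeta k * (1 / real (Suc n) ^ p)"
    using divide_right_mono[OF gen_harm_le_zeta[OF assms(1), of "Suc n"], of "real (Suc n) ^ p"]
    by (simp add: gen_harm_nonneg)
qed

text \<open>A crude growth bound, sufficient against denominators of degree at least 2. By induction
  it reduces to comparing the increments of both sides.\<close>

lemma harm_le_sqrt: "harm n \<le> 2 * sqrt (real n)"
proof (induction n)
  case 0
  then show ?case by (simp add: harm_def)
next
  case (Suc n)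
  have "1 / real (Suc n) \<le> 2 * (sqrt (real (Suc n)) - sqrt (real n))"
  proof -
    define a b where "a = sqrt (real (Suc n))" and "b = sqrt (real n)"
    have ab: "a\<^sup>2 = b\<^sup>2 + 1" "a \<ge> 1" "a\<^sup>2 = real (Suc n)" "b \<ge> 0" "b \<le> a"
      by (auto simp: a_def b_def)
    \<comment> \<open>From \<open>a \<ge> 1\<close> and \<open>b \<le> a\<close>. Next the right
      side is multiplied by \<open>(a - b) * (a + b) = 1\<close>, so that \<open>a + b\<close> can
      be cancelled.\<close>
    have "(a + b) * 1 \<le> (2 * a) * a"
      using ab by (intro mult_mono) auto
    also have "\<dots> = 2 * a\<^sup>2 * ((a - b) * (a + b))"
      using ab(1) by (simp add: power2_eq_square algebra_simps)
    finally have "1 * (a + b) \<le> (2 * a\<^sup>2 * (a - b)) * (a + b)"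
      by (simp add: mult_ac)
    then have "1 \<le> 2 * a\<^sup>2 * (a - b)"
      by (rule mult_right_le_imp_le) (use ab in auto)
    then have "1 / a\<^sup>2 \<le> 2 * (a - b)"
      using ab(2) by (subst pos_divide_le_eq) (auto simp: algebra_simps)
    then show ?thesis
      unfolding ab(3) by (simp add: a_def b_def)
  qed
  with Suc show ?case
    by (simp add: harm_Suc inverse_eq_divide algebra_simps)
qed

text \<open>The terms are largest for \<open>p = 2\<close>, where the square root bound leaves the
  exponent 1/2 - 2 = -3/2.\<close>

lemma summable_harm:
  assumes "p > 1"
  shows "summable (\<lambda>n. harm (Suc n) / real (Suc n) ^ p)"
proof (rule summable_comparison_test'[of "\<lambda>n. 2 * real (Suc n) powr (- (3/2))" 0])
  have "summable (\<lambda>n. real n powr (- (3/2)))"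
    by (subst summable_real_powr_iff) simp
  then show "summable (\<lambda>n. 2 * real (Suc n) powr (- (3/2)))"
    by (intro summable_mult) (subst summable_Suc_iff)
next
  fix n :: nat
  have "harm (Suc n) / real (Suc n) ^ p \<le> 2 * sqrt (real (Suc n)) / real (Suc n) ^ p"
    by (intro divide_right_mono harm_le_sqrt) simp
  also have "\<dots> \<le> 2 * sqrt (real (Suc n)) / real (Suc n) ^ 2"
    using assms by (intro divide_left_mono power_increasing) auto
  also have "\<dots> = 2 * (real (Suc n) powr (1/2) / real (Suc n) powr 2)"
    by (simp add: powr_half_sqrt del: of_nat_Suc)
  also have "\<dots> = 2 * real (Suc n) powr (- (3/2))"
    by (simp flip: powr_diff del: of_nat_Suc powr_numeral)
  finally show "norm (harm (Suc n) / real (Suc n) ^ p) \<le> 2 * real (Suc n) powr (- (3/2))"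
    by (simp add: harm_nonneg)
qed

section \<open>Summation over \<mu>\<close>

theorem theorem4p4:
  fixes r s t :: nat
  assumes "s \<ge> 1" and "t \<ge> 1" and "r + s > 1" and "r + t > 1"
  shows "tornheim r s t =
      (\<Sum>i<s-1. (-1) ^ i * real ((t + i - 1) choose i) * zeta (s - i) * zeta (r + t + i))
    + (-1) ^ s * (\<Sum>i<t-1. real ((s + i - 1) choose i) * zeta (t - i) * zeta (r + s + i))
    - (-1) ^ s * (\<Sum>i<t-1. real ((s + i - 1) choose i) *
          (\<Sum>\<mu>. gen_harm (Suc \<mu>) (int t - int i) / real (Suc \<mu>) ^ (r + s + i)))
    - (-1) ^ s * real ((s + t - 2) choose (t - 1)) *
          (\<Sum>\<mu>. harm (Suc \<mu>) / real (Suc \<mu>) ^ (r + s + t - 1))"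
proof -
  let ?G = "\<lambda>i. \<Sum>\<mu>. gen_harm (Suc \<mu>) (int (t - i)) / real (Suc \<mu>) ^ (r + s + i)"
  let ?H = "\<Sum>\<mu>. harm (Suc \<mu>) / real (Suc \<mu>) ^ (r + s + t - 1)"
  \<comment> \<open>Dividing by the \<open>r\<close>-th power of \<open>Suc \<mu>\<close> only
    raises exponents. Each summand is written as a constant times a term of a convergent series in
    \<mu>, ready for termwise summation.\<close>
  have inner: "(\<Sum>\<nu>. 1 / (real (Suc \<mu>) ^ r * real (Suc \<nu>) ^ s * real (Suc \<mu> + Suc \<nu>) ^ t)) =
      (\<Sum>i<s-1. (-1) ^ i * real ((t + i - 1) choose i) * (zeta (s - i) * (1 / real (Suc \<mu>) ^ (r + t + i))))
    + (-1) ^ s * (\<Sum>i<t-1. real ((s + i - 1) choose i) *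
         (zeta (t - i) * (1 / real (Suc \<mu>) ^ (r + s + i))
          - gen_harm (Suc \<mu>) (int (t - i)) / real (Suc \<mu>) ^ (r + s + i)))
    - (-1) ^ s * real ((s + t - 2) choose (t - 1)) * (harm (Suc \<mu>) / real (Suc \<mu>) ^ (r + s + t - 1))"
    (is "_ = ?rhs \<mu>") for \<mu>
  proof -
    define m where "m = real (Suc \<mu>)"
    have pow: "c / m ^ k / m ^ r = c / m ^ (r + k)" for c k
      by (simp add: power_add mult.commute)
    have recip: "c * (1 / w) = c / w" for c w :: real
      by simp
    have exponent: "r + (s + t - 1) = r + s + t - 1"
      using assms by simp
    have "(\<Sum>\<nu>. 1 / (m ^ r * real (Suc \<nu>) ^ s * real (Suc \<mu> + Suc \<nu>) ^ t)) =
        (\<Sum>\<nu>. 1 / (real (Suc \<nu>) ^ s * real (Suc \<mu> + Suc \<nu>) ^ t) / m ^ r)"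
      by (simp add: mult_ac)
    also have "\<dots> = ?rhs \<mu>"
      unfolding m_def[symmetric]
        sums_unique[OF sums_divide[OF tornheim_inner_sums[OF assms(1,2), of "Suc \<mu>",
          folded m_def, OF le_add1[of 1 \<mu>, unfolded plus_1_eq_Suc]], of "m ^ r"], symmetric]
      by (simp only: add_divide_distrib diff_divide_distrib sum_divide_distrib
          times_divide_eq_right[symmetric] recip pow exponent add.assoc)
    finally show ?thesis
      by (simp only: m_def)
  qed
  have "?rhs sums
      ((\<Sum>i<s-1. (-1) ^ i * real ((t + i - 1) choose i) * (zeta (s - i) * zeta (r + t + i)))
     + (-1) ^ s * (\<Sum>i<t-1. real ((s + i - 1) choose i) * (zeta (t - i) * zeta (r + s + i) - ?G i))
     - (-1) ^ s * real ((s + t - 2) choose (t - 1)) * ?H)"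
    \<comment> \<open>The hypotheses make \<open>r + t + i\<close>, \<open>r + s + i\<close> and
      \<open>r + s + t - 1\<close> all at least 2.\<close>
    using assms
    by (intro sums_add sums_diff sums_mult sums_sum zeta_sums summable_sums
        summable_gen_harm summable_harm) auto
  then have "tornheim r s t =
      (\<Sum>i<s-1. (-1) ^ i * real ((t + i - 1) choose i) * (zeta (s - i) * zeta (r + t + i)))
     + (-1) ^ s * (\<Sum>i<t-1. real ((s + i - 1) choose i) * (zeta (t - i) * zeta (r + s + i) - ?G i))
     - (-1) ^ s * real ((s + t - 2) choose (t - 1)) * ?H"
    unfolding tornheim_def inner by (rule sums_unique[symmetric])
  \<comment> \<open>The theorem subtracts in the integers and \<open>?G\<close> in the naturals; the
    two agree since \<open>i < t\<close>.\<close>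
  moreover have "(\<Sum>i<t-1. real ((s + i - 1) choose i) * ?G i) =
      (\<Sum>i<t-1. real ((s + i - 1) choose i) *
          (\<Sum>\<mu>. gen_harm (Suc \<mu>) (int t - int i) / real (Suc \<mu>) ^ (r + s + i)))"
    by (intro sum.cong refl) (simp add: of_nat_diff)
  ultimately show ?thesis
    by (simp add: right_diff_distrib sum_subtractf mult.assoc)
qed

end
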